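(* For every composition $\beta$, \[H_\beta=\sum_{\alpha\ge_{\mathrm{lex}}\beta}K_{\alpha,\beta}\,{\mathfrak S}_\alpha,\] the sum being over compositions $\alpha$ of $|\beta|$ that are lexicographically at least $\beta$, where $K_{\alpha,\beta}$ is the number of immaculate tableaux of shape $\alpha$ and content $\beta$. In particular the expansion of $H_\beta$ in the immaculate functions is positive and uni-triangular ($K_{\beta,\beta}=1$).
   Context: Work over $\mathbb{Q}$. A composition $\alpha=[\alpha_1,\dots,\alpha_m]$ of $n$ is a sequence of positive integers with sum $|\alpha|=n$, length $\ell(\alpha)=m$. $\mathsf{NSym}$ is the free associative $\mathbb{Q}$-algebra on $H_1,H_2,\dots$ ($\deg H_i=i$); $H_{(a_1,\dots,a_m)}=H_{a_1}\cdots H_{a_m}$, with $H_0=1$, $H_{-r}=0$ for $r>0$. $\mathsf{QSym}$ is the algebra of quasi-symmetric functions with monomial basis $M_\alpha=\sum_{i_1<\dots<i_m}x_{i_1}^{\alpha_1}\cdots x_{i_m}^{\alpha_m}$, paired with $\mathsf{NSym}$ by $\langle H_\alpha,M_\beta\rangle=\delta_{\alpha,\beta}$; for $F\in\mathsf{QSym}$, $F^\perp$ on $\mathsf{NSym}$ is defined by $\langle F^\perp H,G\rangle=\langle H,FG\rangle$ for all $G$. With $D(\alpha)=\{\alpha_1,\alpha_1+\alpha_2,\dots,\alpha_1+\dots+\alpha_{m-1}\}$, refinement is $\alpha\le\beta$ iff $D(\beta)\subseteq D(\alpha)$; $F_\alpha=\sum_{\beta\le\alpha}M_\beta$, and $F_{1^i}=F_{(1,\dots,1)}$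 ($i$ ones, $F_{1^0}=1$). $\mathbb{B}_m=\sum_{i\ge0}(-1)^iH_{m+i}F_{1^i}^\perp$, and for $\alpha\in\mathbb{Z}^m$, ${\mathfrak S}_\alpha=\mathbb{B}_{\alpha_1}\cdots\mathbb{B}_{\alpha_m}(1)$. An immaculate tableau of shape $\alpha$ and content $\beta$ (compositions) is a filling of the diagram of $\alpha$ (row $j$ has $\alpha_j$ boxes, rows numbered from the top, left-justified) with positive integers such that exactly $\beta_i$ boxes contain $i$, entries weakly increase from left to right along each row, and the entries of the first column strictly increase from top (row 1) to bottom; no condition is imposed on other columns. *)

theory Defs
  imports Complex_Main "HOL-Library.Poly_Mapping" "HOL-Library.Groups_Big_Fun"
begin

section \<open>Compositions\<close>

typedef composition = "{xs :: nat list. 0 \<notin> set xs}"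
  morphisms parts Composition
  by (rule exI[of _ "[]"]) simp

setup_lifting type_definition_composition

text \<open>Under concatenation, compositions are the free monoid on the positive integers.\<close>

instantiation composition :: monoid_add
begin

lift_definition zero_composition :: composition is "[]" by simp

lift_definition plus_composition :: "composition \<Rightarrow> composition \<Rightarrow> composition" is "(@)" by simp

instance by standard (transfer, simp)+

end

definition wt :: "composition \<Rightarrow> nat" where
  "wt \<alpha> = sum_list (parts \<alpha>)"

lemma finite_wt: "finite {\<alpha>. wt \<alpha> = n}"
proof -
  have "parts ` {\<alpha>. wt \<alpha> = n} \<subseteq> {xs. set xs \<subseteq> {..n} \<and> length xs \<le> n}"
  proof (clarsimp simp: wt_def, intro conjI)
    fix \<alpha> assume n: "n = sum_list (parts \<alpha>)"
    show "set (parts \<alpha>) \<subseteq> {..sum_list (parts \<alpha>)}" by (auto intro: member_le_sum_list)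
    have "0 \<notin> set xs \<Longrightarrow> length xs \<le> sum_list xs" for xs :: "nat list"
      by (induction xs) auto
    then show "length (parts \<alpha>) \<le> sum_list (parts \<alpha>)" using parts[of \<alpha>] by simp
  qed
  then have "finite (parts ` {\<alpha>. wt \<alpha> = n})"
    by (rule finite_subset) (simp add: finite_lists_length_le)
  then show ?thesis by (rule finite_imageD) (simp add: inj_on_def parts_inject)
qed

definition len :: "composition \<Rightarrow> nat" where
  "len \<alpha> = length (parts \<alpha>)"

definition descents :: "composition \<Rightarrow> nat set" where
  "descents \<alpha> = {sum_list (take k (parts \<alpha>)) |k. 1 \<le> k \<and> k < len \<alpha>}"

text \<open>\<open>refines \<beta> \<alpha>\<close> is \<open>\<beta> \<le> \<alpha>\<close>: \<open>\<beta>\<close> is finer than \<open>\<alpha>\<close>.\<close>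

definition refines :: "composition \<Rightarrow> composition \<Rightarrow> bool" where
  "refines \<beta> \<alpha> \<longleftrightarrow> wt \<beta> = wt \<alpha> \<and> descents \<alpha> \<subseteq> descents \<beta>"

definition lex_le :: "composition \<Rightarrow> composition \<Rightarrow> bool" where
  "lex_le \<beta> \<alpha> \<longleftrightarrow> lexordp_eq (parts \<beta>) (parts \<alpha>)"

lift_definition ones :: "nat \<Rightarrow> composition" is "\<lambda>i. replicate i 1" by simp


section \<open>Noncommutative symmetric functions\<close>

text \<open>
  The free associative algebra on the generators \<open>H\<^sub>1, H\<^sub>2, \<dots>\<close> is the monoid algebra over the
  rationals of the free monoid of compositions: the basis element of \<open>\<alpha>\<close> is the word
  \<open>H\<^sub>\<alpha>\<^sub>1 \<cdots> H\<^sub>\<alpha>\<^sub>m\<close> (see \<open>Hword_parts\<close> below), and the product is convolution along concatenation.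
\<close>

type_synonym nsym = "composition \<Rightarrow>\<^sub>0 rat"

text \<open>The index is an integer, with \<open>H\<^sub>0 = 1\<close> and \<open>H\<^sub>r = 0\<close> for negative \<open>r\<close>.\<close>

definition H :: "int \<Rightarrow> nsym" where
  "H r = (if r < 0 then 0 else if r = 0 then 1
          else Poly_Mapping.single (Composition [nat r]) 1)"

definition Hword :: "int list \<Rightarrow> nsym" where
  "Hword as = prod_list (map H as)"

definition int_parts :: "composition \<Rightarrow> int list" where
  "int_parts \<alpha> = map int (parts \<alpha>)"

lemma Hword_parts: "Hword (int_parts \<alpha>) = Poly_Mapping.single \<alpha> 1"
proof -
  have "0 \<notin> set xs \<Longrightarrow>
      prod_list (map H (map int xs)) = Poly_Mapping.single (Composition xs) 1" for xs
  proof (induction xs)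
    case Nil
    have "Composition [] = 0" by (simp add: zero_composition_def)
    then show ?case by simp
  next
    case (Cons x xs)
    then have x: "0 < x" and xs: "0 \<notin> set xs" by auto
    have "Composition [x] + Composition xs = Composition (x # xs)"
      using x xs by (simp add: plus_composition.rep_eq Composition_inverse flip: parts_inject)
    then show ?case using Cons.IH[OF xs] x by (simp add: H_def mult_single)
  qed
  from this[of "parts \<alpha>"] show ?thesis
    using parts[of \<alpha>] by (simp add: Hword_def int_parts_def parts_inverse)
qed


section \<open>Quasi-symmetric functions\<close>

text \<open>
  A formal power series in the countably many variables \<open>x\<^sub>0 < x\<^sub>1 < \<dots>\<close> is the function
  taking a monomial (an exponent vector of finite support) to its coefficient.
\<close>

type_synonym monomial = "nat \<Rightarrow>\<^sub>0 nat"
type_synonym series = "monomial \<Rightarrow> rat"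

definition series_mult :: "series \<Rightarrow> series \<Rightarrow> series" where
  "series_mult F G = (\<lambda>m. \<Sum>(a, b) \<in> {(a, b). a + b = m}. F a * G b)"

lemma finite_splittings: "finite {(a, b). a + b = (m :: monomial)}"
proof -
  let ?L = "{a :: monomial. \<forall>j. Poly_Mapping.lookup a j \<le> Poly_Mapping.lookup m j}"
  let ?N = "sum (Poly_Mapping.lookup m) (Poly_Mapping.keys m)"
  let ?S = "{f. \<forall>j. (j \<in> Poly_Mapping.keys m \<longrightarrow> f j \<in> {..?N}) \<and> (j \<notin> Poly_Mapping.keys m \<longrightarrow> f j = (0::nat))}"
  have "Poly_Mapping.lookup a \<in> ?S" if "a \<in> ?L" for a
  proof (clarify, intro conjI impI)
    fix j
    have le: "Poly_Mapping.lookup a j \<le> Poly_Mapping.lookup m j" using that by simp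
    show "Poly_Mapping.lookup a j = 0" if "j \<notin> Poly_Mapping.keys m" using that le by (simp add: in_keys_iff)
    assume "j \<in> Poly_Mapping.keys m"
    then have "Poly_Mapping.lookup m j \<le> ?N" by (intro member_le_sum) auto
    then show "Poly_Mapping.lookup a j \<in> {..?N}" using le by simp
  qed
  then have "Poly_Mapping.lookup ` ?L \<subseteq> ?S" by (rule image_subsetI)
  moreover have "finite ?S"
    by (rule finite_set_of_finite_funs[OF finite_keys finite_atMost])
  ultimately have "finite (Poly_Mapping.lookup ` ?L)"
    by (rule finite_subset)
  then have "finite ?L" by (rule finite_imageD) (simp add: inj_on_def)
  then have "finite (?L \<times> ?L)" by simp
  then show ?thesis by (rule finite_subset[rotated]) (auto simp: lookup_add)
qed

text \<open>The monomial \<open>x\<^bsub>i\<^sub>1\<^esub>\<^bsup>a\<^sub>1\<^esup> \<cdots> x\<^bsub>i\<^sub>m\<^esub>\<^bsup>a\<^sub>m\<^esup>\<close>.\<close>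

definition monomial_of :: "nat list \<Rightarrow> nat list \<Rightarrow> monomial" where
  "monomial_of is as = sum_list (map2 Poly_Mapping.single is as)"

lemma lookup_monomial_of_notin:
  "j \<notin> set is \<Longrightarrow> Poly_Mapping.lookup (monomial_of is as) j = 0"
proof (induction "is" arbitrary: as)
  case (Cons i "is")
  then show ?case by (cases as) (auto simp: monomial_of_def lookup_add lookup_single)
qed (simp add: monomial_of_def)

lemma lookup_monomial_of_nth:
  assumes "length is = length as" "distinct is" "k < length is"
  shows "Poly_Mapping.lookup (monomial_of is as) (is ! k) = as ! k"
  using assms
proof (induction "is" as arbitrary: k rule: list_induct2)
  case (Cons i "is" a as)
  have eq: "monomial_of (i # is) (a # as) = Poly_Mapping.single i a + monomial_of is as"
    by (simp add: monomial_of_def)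
  show ?case
  proof (cases k)
    case 0
    then show ?thesis using Cons.prems
      by (simp add: eq lookup_add lookup_monomial_of_notin)
  next
    case (Suc l)
    then have "is ! l \<noteq> i" using Cons.prems by auto
    then show ?thesis using Suc Cons by (simp add: eq lookup_add lookup_single)
  qed
qed simp

lemma monomial_of_eqD:
  assumes "monomial_of is (parts \<alpha>) = monomial_of js (parts \<beta>)"
    and "length is = len \<alpha>" "length js = len \<beta>" "sorted_wrt (<) is" "sorted_wrt (<) js"
  shows "is = js \<and> \<alpha> = \<beta>"
proof -
  have keys: "Poly_Mapping.keys (monomial_of ks (parts \<gamma>)) = set ks"
    if "length ks = len \<gamma>" "sorted_wrt (<) ks" for ks \<gamma>
  proof -
    have nz: "parts \<gamma> ! k \<noteq> 0" if "k < len \<gamma>" for k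
      using that parts[of \<gamma>] nth_mem[of k "parts \<gamma>"] unfolding len_def by (metis mem_Collect_eq)
    have "j \<in> Poly_Mapping.keys (monomial_of ks (parts \<gamma>))" if "j \<in> set ks" for j
    proof -
      from that obtain k where k: "k < length ks" "j = ks ! k" by (auto simp: in_set_conv_nth)
      then have "Poly_Mapping.lookup (monomial_of ks (parts \<gamma>)) j = parts \<gamma> ! k"
        using \<open>length ks = len \<gamma>\<close> \<open>sorted_wrt (<) ks\<close>
        by (simp add: lookup_monomial_of_nth len_def strict_sorted_iff)
      then show ?thesis using nz[of k] k \<open>length ks = len \<gamma>\<close> by (simp add: in_keys_iff)
    qed
    moreover have "j \<in> set ks" if "j \<in> Poly_Mapping.keys (monomial_of ks (parts \<gamma>))" for j
      using that lookup_monomial_of_notin by (fastforce simp: in_keys_iff)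
    ultimately show ?thesis by blast
  qed
  have "set is = set js" using keys[of "is" \<alpha>] keys[of js \<beta>] assms by metis
  then have eq: "is = js" using assms(4,5) by (simp add: strict_sorted_equal)
  have "parts \<alpha> = parts \<beta>"
  proof (rule nth_equalityI)
    show "length (parts \<alpha>) = length (parts \<beta>)" using assms eq by (simp add: len_def)
    fix k assume "k < length (parts \<alpha>)"
    then have k: "k < length is" "k < length js" using assms(2) eq by (simp_all add: len_def)
    have "parts \<alpha> ! k = Poly_Mapping.lookup (monomial_of is (parts \<alpha>)) (is ! k)"
      by (rule lookup_monomial_of_nth[symmetric])
         (use assms(2,4) k in \<open>simp_all add: len_def strict_sorted_iff\<close>)
    also have "\<dots> = Poly_Mapping.lookup (monomial_of js (parts \<beta>)) (js ! k)"
      using assms(1) unfolding eq by (rule arg_cong)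
    also have "\<dots> = parts \<beta> ! k"
      by (rule lookup_monomial_of_nth)
         (use assms(3,5) k in \<open>simp_all add: len_def strict_sorted_iff\<close>)
    finally show "parts \<alpha> ! k = parts \<beta> ! k" .
  qed
  then show ?thesis using eq by (simp add: parts_inject)
qed

text \<open>
  The coefficient of a monomial in \<open>\<Sum>\<^bsub>i\<^sub>1 < \<dots> < i\<^sub>m\<^esub> x\<^bsub>i\<^sub>1\<^esub>\<^bsup>\<alpha>\<^sub>1\<^esup> \<cdots> x\<^bsub>i\<^sub>m\<^esub>\<^bsup>\<alpha>\<^sub>m\<^esup>\<close> is the number of index
  sequences that yield it.
\<close>

definition M :: "composition \<Rightarrow> series" where
  "M \<alpha> = (\<lambda>m. of_nat (card {is. length is = len \<alpha> \<and> sorted_wrt (<) is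
                              \<and> monomial_of is (parts \<alpha>) = m}))"

definition QSym :: "series set" where
  "QSym = {\<lambda>m. \<Sum>\<alpha>\<in>Poly_Mapping.keys c. Poly_Mapping.lookup c \<alpha> * M \<alpha> m | c :: composition \<Rightarrow>\<^sub>0 rat. True}"

lemma M_neq_0D:
  assumes "M \<alpha> m \<noteq> 0"
  shows "\<exists>is. length is = len \<alpha> \<and> sorted_wrt (<) is \<and> monomial_of is (parts \<alpha>) = m"
proof (rule ccontr)
  assume "\<not> ?thesis"
  then have empty: "{is. length is = len \<alpha> \<and> sorted_wrt (<) is \<and> monomial_of is (parts \<alpha>) = m} = {}"
    by blast
  from assms show False unfolding M_def empty by simp
qed

lemma M_in_QSym: "M \<alpha> \<in> QSym"
  unfolding QSym_def
  by (rule CollectI, rule exI[of _ "Poly_Mapping.single \<alpha> 1"]) simp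

definition F :: "composition \<Rightarrow> series" where
  "F \<alpha> = (\<lambda>m. \<Sum>\<beta> | refines \<beta> \<alpha>. M \<beta> m)"


section \<open>The pairing and its adjoints\<close>

text \<open>
  The coefficient of \<open>M\<^sub>\<alpha>\<close> in a quasi-symmetric function is its coefficient at the monomial
  \<open>x\<^sub>0\<^bsup>\<alpha>\<^sub>1\<^esup> x\<^sub>1\<^bsup>\<alpha>\<^sub>2\<^esup> \<cdots>\<close>; so the bilinear form below is the one that makes the \<open>H\<^sub>\<alpha>\<close> and the \<open>M\<^sub>\<alpha>\<close>
  dual bases, as \<open>pairing_Hword_M\<close> confirms.
\<close>

definition M_coeff :: "series \<Rightarrow> composition \<Rightarrow> rat" where
  "M_coeff G \<alpha> = G (monomial_of [0..<len \<alpha>] (parts \<alpha>))"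

lemma M_coeff_M: "M_coeff (M \<beta>) \<alpha> = (if \<alpha> = \<beta> then 1 else 0)"
proof (cases "\<alpha> = \<beta>")
  case True
  have "{is. length is = len \<alpha> \<and> sorted_wrt (<) is
         \<and> monomial_of is (parts \<alpha>) = monomial_of [0..<len \<alpha>] (parts \<alpha>)} = {[0..<len \<alpha>]}"
    using monomial_of_eqD[of _ \<alpha> "[0..<len \<alpha>]" \<alpha>] by auto
  then show ?thesis using True by (simp add: M_coeff_def M_def)
next
  case False
  then have "M \<beta> (monomial_of [0..<len \<alpha>] (parts \<alpha>)) = 0"
    using M_neq_0D monomial_of_eqD[of _ \<beta> "[0..<len \<alpha>]" \<alpha>] by fastforce
  then show ?thesis using False by (simp add: M_coeff_def)
qed

definition pairing :: "nsym \<Rightarrow> series \<Rightarrow> rat" where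
  "pairing X G = (\<Sum>\<alpha>\<in>Poly_Mapping.keys X. Poly_Mapping.lookup X \<alpha> * M_coeff G \<alpha>)"

lemma pairing_M: "pairing X (M \<alpha>) = Poly_Mapping.lookup X \<alpha>"
proof -
  have "pairing X (M \<alpha>) = (\<Sum>\<gamma>\<in>Poly_Mapping.keys X. if \<gamma> = \<alpha> then Poly_Mapping.lookup X \<alpha> else 0)"
    unfolding pairing_def by (intro sum.cong) (auto simp: M_coeff_M)
  then show ?thesis by (simp add: sum.delta in_keys_iff)
qed

lemma pairing_Hword_M: "pairing (Hword (int_parts \<alpha>)) (M \<beta>) = (if \<alpha> = \<beta> then 1 else 0)"
  by (simp add: pairing_M Hword_parts lookup_single when_def)

lemma pairing_sum:
  fixes G :: "'a \<Rightarrow> series"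
  shows "pairing X (\<lambda>m. \<Sum>\<alpha>\<in>A. c \<alpha> * G \<alpha> m) = (\<Sum>\<alpha>\<in>A. c \<alpha> * pairing X (G \<alpha>))"
proof -
  let ?x = "Poly_Mapping.lookup X"
  have "pairing X (\<lambda>m. \<Sum>\<alpha>\<in>A. c \<alpha> * G \<alpha> m)
      = (\<Sum>\<gamma>\<in>Poly_Mapping.keys X. \<Sum>\<alpha>\<in>A. c \<alpha> * (?x \<gamma> * M_coeff (G \<alpha>) \<gamma>))"
    unfolding pairing_def M_coeff_def sum_distrib_left by (simp only: mult.left_commute)
  also have "\<dots> = (\<Sum>\<alpha>\<in>A. \<Sum>\<gamma>\<in>Poly_Mapping.keys X. c \<alpha> * (?x \<gamma> * M_coeff (G \<alpha>) \<gamma>))"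
    by (rule sum.swap)
  also have "\<dots> = (\<Sum>\<alpha>\<in>A. c \<alpha> * pairing X (G \<alpha>))"
    unfolding pairing_def sum_distrib_left ..
  finally show ?thesis .
qed

lemma series_mult_sum:
  fixes E :: "'a \<Rightarrow> series"
  shows "series_mult G (\<lambda>m. \<Sum>\<alpha>\<in>A. c \<alpha> * E \<alpha> m) = (\<lambda>m. \<Sum>\<alpha>\<in>A. c \<alpha> * series_mult G (E \<alpha>) m)"
proof
  fix m :: monomial
  let ?S = "{(a, b). a + b = m}"
  have "series_mult G (\<lambda>m. \<Sum>\<alpha>\<in>A. c \<alpha> * E \<alpha> m) m
      = (\<Sum>p\<in>?S. \<Sum>\<alpha>\<in>A. c \<alpha> * (G (fst p) * E \<alpha> (snd p)))"
    unfolding series_mult_def case_prod_unfold sum_distrib_left by (simp only: mult.left_commute)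
  also have "\<dots> = (\<Sum>\<alpha>\<in>A. \<Sum>p\<in>?S. c \<alpha> * (G (fst p) * E \<alpha> (snd p)))"
    by (rule sum.swap)
  also have "\<dots> = (\<Sum>\<alpha>\<in>A. c \<alpha> * series_mult G (E \<alpha>) m)"
    unfolding series_mult_def case_prod_unfold sum_distrib_left ..
  finally show "series_mult G (\<lambda>m. \<Sum>\<alpha>\<in>A. c \<alpha> * E \<alpha> m) m
      = (\<Sum>\<alpha>\<in>A. c \<alpha> * series_mult G (E \<alpha>) m)" .
qed

text \<open>Existence and uniqueness of the adjoint are \<open>perp_pairing\<close> and \<open>perp_unique\<close> below.\<close>

definition perp :: "series \<Rightarrow> nsym \<Rightarrow> nsym" where
  "perp G X = (THE Y. \<forall>E\<in>QSym. pairing Y E = pairing X (series_mult G E))"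

lemma perp_unique:
  assumes "\<forall>E\<in>QSym. pairing Y E = pairing Z E"
  shows "Y = Z"
proof (rule poly_mapping_eqI)
  fix \<alpha>
  show "Poly_Mapping.lookup Y \<alpha> = Poly_Mapping.lookup Z \<alpha>"
    using bspec[OF assms M_in_QSym[of \<alpha>]] by (simp only: pairing_M)
qed

lemma perp_exists: "\<exists>Y. \<forall>E\<in>QSym. pairing Y E = pairing X (series_mult G E)"
proof -
  define y where "y = (\<lambda>\<alpha>. pairing X (series_mult G (M \<alpha>)))"
  have fin1: "finite {\<alpha>. M \<alpha> b \<noteq> 0}" for b
  proof (cases "{\<alpha>. M \<alpha> b \<noteq> 0} = {}")
    case False
    then obtain \<alpha> where "M \<alpha> b \<noteq> 0" by blast
    then have "{\<alpha>. M \<alpha> b \<noteq> 0} \<subseteq> {\<alpha>}" using M_neq_0D monomial_of_eqD by blast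
    then show ?thesis using finite_subset by blast
  qed simp
  have fin2: "finite {\<alpha>. series_mult G (M \<alpha>) m \<noteq> 0}" for m
  proof (rule finite_subset)
    show "{\<alpha>. series_mult G (M \<alpha>) m \<noteq> 0}
          \<subseteq> (\<Union>p\<in>{(a, b). a + b = m}. {\<alpha>. M \<alpha> (snd p) \<noteq> 0})"
    proof
      fix \<alpha> assume "\<alpha> \<in> {\<alpha>. series_mult G (M \<alpha>) m \<noteq> 0}"
      then obtain p where "p \<in> {(a, b). a + b = m}" "(case p of (a, b) \<Rightarrow> G a * M \<alpha> b) \<noteq> 0"
        unfolding series_mult_def by (meson mem_Collect_eq sum.not_neutral_contains_not_neutral)
      then show "\<alpha> \<in> (\<Union>p\<in>{(a, b). a + b = m}. {\<alpha>. M \<alpha> (snd p) \<noteq> 0})"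
        by (intro UN_I[of p]) (auto split: prod.splits)
    qed
    show "finite (\<Union>p\<in>{(a, b). a + b = m}. {\<alpha>. M \<alpha> (snd p) \<noteq> 0})"
      using finite_splittings fin1 by blast
  qed
  have "finite {\<alpha>. y \<alpha> \<noteq> 0}"
  proof (rule finite_subset)
    let ?mon = "\<lambda>\<gamma>. monomial_of [0..<len \<gamma>] (parts \<gamma>)"
    show "{\<alpha>. y \<alpha> \<noteq> 0} \<subseteq> (\<Union>\<gamma>\<in>Poly_Mapping.keys X. {\<alpha>. series_mult G (M \<alpha>) (?mon \<gamma>) \<noteq> 0})"
    proof
      fix \<alpha> assume "\<alpha> \<in> {\<alpha>. y \<alpha> \<noteq> 0}"
      then have "(\<Sum>\<gamma>\<in>Poly_Mapping.keys X. Poly_Mapping.lookup X \<gamma> * M_coeff (series_mult G (M \<alpha>)) \<gamma>) \<noteq> 0"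
        by (simp only: y_def pairing_def mem_Collect_eq not_False_eq_True)
      then obtain \<gamma> where "\<gamma> \<in> Poly_Mapping.keys X"
          "Poly_Mapping.lookup X \<gamma> * M_coeff (series_mult G (M \<alpha>)) \<gamma> \<noteq> 0"
        by (rule sum.not_neutral_contains_not_neutral)
      then show "\<alpha> \<in> (\<Union>\<gamma>\<in>Poly_Mapping.keys X. {\<alpha>. series_mult G (M \<alpha>) (?mon \<gamma>) \<noteq> 0})"
        by (auto simp: M_coeff_def)
    qed
    show "finite (\<Union>\<gamma>\<in>Poly_Mapping.keys X. {\<alpha>. series_mult G (M \<alpha>) (?mon \<gamma>) \<noteq> 0})"
      by (intro finite_UN_I finite_keys fin2)
  qed
  then have "Poly_Mapping.lookup (Abs_poly_mapping y) = y" by simp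
  then have Y: "pairing (Abs_poly_mapping y) (M \<alpha>) = pairing X (series_mult G (M \<alpha>))" for \<alpha>
    by (simp only: pairing_M) (simp only: y_def)
  show ?thesis
  proof (intro exI ballI)
    fix E assume "E \<in> QSym"
    then obtain c where E: "E = (\<lambda>m. \<Sum>\<alpha>\<in>Poly_Mapping.keys c. Poly_Mapping.lookup c \<alpha> * M \<alpha> m)"
      unfolding QSym_def by blast
    show "pairing (Abs_poly_mapping y) E = pairing X (series_mult G E)"
      unfolding E series_mult_sum pairing_sum Y ..
  qed
qed

lemma perp_pairing:
  assumes "E \<in> QSym"
  shows "pairing (perp G X) E = pairing X (series_mult G E)"
proof -
  have "\<exists>!Y. \<forall>E\<in>QSym. pairing Y E = pairing X (series_mult G E)"
  proof (rule ex_ex1I[OF perp_exists])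
    fix Y Z
    assume "\<forall>E\<in>QSym. pairing Y E = pairing X (series_mult G E)"
      and "\<forall>E\<in>QSym. pairing Z E = pairing X (series_mult G E)"
    then show "Y = Z" by (intro perp_unique) simp
  qed
  from theI'[OF this] show ?thesis using assms unfolding perp_def by blast
qed


section \<open>Immaculate functions\<close>

text \<open>
  The sum over \<open>i\<close> is the library's sum of a finitely supported family; the adjoint of \<open>F\<^bsub>1^i\<^esub>\<close>
  kills \<open>X\<close> as soon as \<open>i\<close> exceeds the degree of \<open>X\<close>.
\<close>

definition B :: "int \<Rightarrow> nsym \<Rightarrow> nsym" where
  "B m X = Sum_any (\<lambda>i::nat. (-1) ^ i * H (m + int i) * perp (F (ones i)) X)"

definition immaculate :: "int list \<Rightarrow> nsym" where
  "immaculate as = foldr B as 1"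


section \<open>Immaculate tableaux\<close>

text \<open>A tableau is the list of its rows, from top to bottom.\<close>

definition immaculate_tableaux :: "composition \<Rightarrow> composition \<Rightarrow> nat list list set" where
  "immaculate_tableaux \<alpha> \<beta> = {T. map length T = parts \<alpha>
     \<and> (\<forall>row\<in>set T. 0 \<notin> set row \<and> sorted row)
     \<and> sorted_wrt (<) (map hd T)
     \<and> (\<forall>i\<ge>1. count_list (concat T) i = (if i \<le> len \<beta> then parts \<beta> ! (i - 1) else 0))}"

lemma finite_immaculate_tableaux: "finite (immaculate_tableaux \<alpha> \<beta>)"
proof (rule finite_subset)
  let ?R = "{row :: nat list. set row \<subseteq> {..len \<beta>} \<and> length row \<le> wt \<alpha>}"
  show "immaculate_tableaux \<alpha> \<beta> \<subseteq> {T. set T \<subseteq> ?R \<and> length T = len \<alpha>}"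
  proof
    fix T assume T: "T \<in> immaculate_tableaux \<alpha> \<beta>"
    then have shape: "map length T = parts \<alpha>"
      and cnt: "\<forall>i\<ge>1. count_list (concat T) i = (if i \<le> len \<beta> then parts \<beta> ! (i - 1) else 0)"
      by (auto simp: immaculate_tableaux_def)
    have "length T = len \<alpha>" using arg_cong[OF shape, of length] by (simp add: len_def)
    moreover have "row \<in> ?R" if row: "row \<in> set T" for row
    proof -
      have "length row \<in> set (parts \<alpha>)" using row shape by (metis image_eqI set_map)
      then have "length row \<le> wt \<alpha>" by (simp add: wt_def member_le_sum_list)
      moreover have "i \<le> len \<beta>" if "i \<in> set row" for i
      proof (rule ccontr)
        assume "\<not> i \<le> len \<beta>"
        then have "count_list (concat T) i = 0" using cnt by simp
        then show False using that row by (auto simp: count_list_0_iff)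
      qed
      ultimately show ?thesis by auto
    qed
    ultimately show "T \<in> {T. set T \<subseteq> ?R \<and> length T = len \<alpha>}" by blast
  qed
  have "finite ?R" by (rule finite_lists_length_le) simp
  then show "finite {T. set T \<subseteq> ?R \<and> length T = len \<alpha>}" by (rule finite_lists_length_eq)
qed

definition K :: "composition \<Rightarrow> composition \<Rightarrow> nat" where
  "K \<alpha> \<beta> = card (immaculate_tableaux \<alpha> \<beta>)"

end

theory Submission
  imports Defs
begin

text \<open>
  The adjoint of \<open>F\<^bsub>1^i\<^esub> = M\<^bsub>1^i\<^esub>\<close> satisfies a Leibniz rule
  \<open>F\<^bsub>1^i\<^esub>\<^sup>\<bottom> (X H\<^sub>s) = (F\<^bsub>1^i\<^esub>\<^sup>\<bottom> X) H\<^sub>s + (F\<^bsub>1^(i-1)\<^esub>\<^sup>\<bottom> X) H\<^bsub>s-1\<^esub>\<close>, which turns into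
  \<open>B\<^sub>m(X) H\<^sub>s = B\<^sub>m(X H\<^sub>s) + B\<^bsub>m+1\<^esub>(X) H\<^bsub>s-1\<^esub>\<close> and, iterated, into
  \<open>B\<^sub>m(X) H\<^sub>s = \<Sum>\<^bsub>k \<le> s\<^esub> B\<^bsub>m+k\<^esub>(X H\<^bsub>s-k\<^esub>)\<close>. Hence multiplying an immaculate function on the right
  by \<open>H\<^sub>s\<close> distributes \<open>s\<close> new boxes over the ends of the rows and one new last row, which is how an
  immaculate tableau grows when \<open>s\<close> copies of a new largest entry are added to it. Such a step
  never decreases the shape lexicographically, and the shape stays equal to the content only if all
  \<open>s\<close> boxes go to the new row.
\<close>

section \<open>The adjoints of the quasi-symmetric functions indexed by columns\<close>

lemma sum_monomials:
  fixes X :: "'a \<Rightarrow>\<^sub>0 'b::comm_monoid_add"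
  shows "X = (\<Sum>\<alpha>\<in>Poly_Mapping.keys X. Poly_Mapping.single \<alpha> (Poly_Mapping.lookup X \<alpha>))"
  by (rule poly_mapping_eqI)
     (auto simp: lookup_sum lookup_single when_def sum.delta in_keys_iff)

text \<open>The unique composition \<gamma> such that \<open>M \<gamma>\<close> contains the
  monomial \<open>b\<close>. Each \<open>M \<gamma>\<close> thus becomes the indicator function of a
  fibre of \<open>flat\<close> (\<open>M_eq_flat\<close>).\<close>

definition flat :: "monomial \<Rightarrow> composition" where
  "flat b = Composition (map (Poly_Mapping.lookup b) (sorted_list_of_set (Poly_Mapping.keys b)))"

lemma parts_flat:
  "parts (flat b) = map (Poly_Mapping.lookup b) (sorted_list_of_set (Poly_Mapping.keys b))"
  unfolding flat_def by (rule Composition_inverse) (auto simp: in_keys_iff)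

lemma monomial_of_flat:
  "monomial_of (sorted_list_of_set (Poly_Mapping.keys b)) (parts (flat b)) = b"
proof (rule poly_mapping_eqI)
  fix j
  let ?is = "sorted_list_of_set (Poly_Mapping.keys b)"
  show "Poly_Mapping.lookup (monomial_of ?is (parts (flat b))) j = Poly_Mapping.lookup b j"
  proof (cases "j \<in> Poly_Mapping.keys b")
    case True
    then obtain k where k: "k < length ?is" "?is ! k = j"
      by (metis finite_keys in_set_conv_nth set_sorted_list_of_set)
    then show ?thesis
      using lookup_monomial_of_nth[of ?is "parts (flat b)" k] by (simp add: parts_flat)
  next
    case False
    then show ?thesis
      by (simp add: lookup_monomial_of_notin in_keys_iff)
  qed
qed

lemma M_eq_flat: "M \<gamma> b = (if flat b = \<gamma> then 1 else 0)"
proof -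
  let ?is = "sorted_list_of_set (Poly_Mapping.keys b)"
  have len: "length ?is = len (flat b)" by (simp add: len_def parts_flat)
  have "length js = len \<gamma> \<and> sorted_wrt (<) js \<and> monomial_of js (parts \<gamma>) = b
      \<longleftrightarrow> js = ?is \<and> flat b = \<gamma>" for js
  proof
    assume "length js = len \<gamma> \<and> sorted_wrt (<) js \<and> monomial_of js (parts \<gamma>) = b"
    then have "js = ?is \<and> \<gamma> = flat b"
      using len monomial_of_flat[of b] by (intro monomial_of_eqD) simp_all
    then show "js = ?is \<and> flat b = \<gamma>" by simp
  next
    assume "js = ?is \<and> flat b = \<gamma>"
    then show "length js = len \<gamma> \<and> sorted_wrt (<) js \<and> monomial_of js (parts \<gamma>) = b"
      using len monomial_of_flat[of b] by auto
  qed
  then show ?thesis by (simp add: M_def)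
qed

text \<open>The case 0 gives the empty composition, so that \<open>H (int s)\<close> is the basis
  element of \<open>comp1 s\<close> for every natural \<open>s\<close>, including
  \<open>H 0 = 1\<close>.\<close>

definition comp1 :: "nat \<Rightarrow> composition" where
  "comp1 s = (if s = 0 then 0 else Composition [s])"

lemma parts_comp1: "parts (comp1 s) = (if s = 0 then [] else [s])"
  by (simp add: comp1_def Composition_inverse zero_composition.rep_eq)

lemma H_of_nat: "H (int s) = Poly_Mapping.single (comp1 s) 1"
  by (simp add: H_def comp1_def single_one)

text \<open>The variable \<open>n\<close> comes after all variables of \<open>b\<close>, so its
  exponent is read last; exponent 0 is not read at all, in agreement with
  \<open>comp1 0 = 0\<close>.\<close>

lemma flat_add_single:
  assumes "Poly_Mapping.keys b \<subseteq> {..<n}"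
  shows "flat (b + Poly_Mapping.single n t) = flat b + comp1 t"
proof (cases "t = 0")
  case False
  have n: "n \<notin> Poly_Mapping.keys b" using assms by auto
  have keys: "Poly_Mapping.keys (b + Poly_Mapping.single n t) = insert n (Poly_Mapping.keys b)"
    using False n by (auto simp: in_keys_iff lookup_add lookup_single when_def split: if_splits)
  have "sorted_list_of_set (insert n (Poly_Mapping.keys b)) = sorted_list_of_set (Poly_Mapping.keys b) @ [n]"
    using assms n
    by (intro sorted_distinct_set_unique) (auto simp: sorted_append less_imp_le set_insort_key sorted_insort distinct_insort)
  then show ?thesis using False n
    by (auto simp: parts_flat keys plus_composition.rep_eq parts_comp1 lookup_add lookup_single when_def
        in_keys_iff simp flip: parts_inject)
qed (simp add: comp1_def)

lemma flat_zero: "flat 0 = 0"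
  by (simp add: parts_flat zero_composition.rep_eq flip: parts_inject)

text \<open>The column has all of \<open>{1..<i}\<close> as descents, so a refinement has at least
  \<open>i\<close> parts; these are positive with sum \<open>i\<close>, hence all 1. This is why F
  and M agree on columns.\<close>

lemma refines_ones: "refines \<beta> (ones i) \<longleftrightarrow> \<beta> = ones i"
proof
  assume r: "refines \<beta> (ones i)"
  have wt: "sum_list (parts \<beta>) = i" using r
    by (simp add: refines_def wt_def ones.rep_eq sum_list_replicate)
  have ge: "0 \<notin> set xs \<Longrightarrow> length xs \<le> sum_list xs" for xs :: "nat list"
    by (induction xs) auto
  have eq: "0 \<notin> set xs \<Longrightarrow> sum_list xs \<le> length xs \<Longrightarrow> xs = replicate (length xs) 1" for xs :: "nat list"
  proof (induction xs)
    case (Cons x xs)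
    then show ?case using ge[of xs] by auto
  qed simp
  have "i \<le> len \<beta>"
  proof (cases "i = 0")
    case False
    have "{1..<i} \<subseteq> descents (ones i)"
    proof
      fix k assume k: "k \<in> {1..<i}"
      then have "k = sum_list (take k (parts (ones i)))"
        by (simp add: ones.rep_eq sum_list_replicate)
      moreover have "1 \<le> k \<and> k < len (ones i)"
        using k by (simp add: len_def ones.rep_eq)
      ultimately show "k \<in> descents (ones i)" unfolding descents_def by blast
    qed
    also have "\<dots> \<subseteq> descents \<beta>" using r by (simp add: refines_def)
    also have "\<dots> = (\<lambda>k. sum_list (take k (parts \<beta>))) ` {1..<len \<beta>}"
      by (auto simp: descents_def)
    finally have "card {1..<i} \<le> card {1..<len \<beta>}"
      by (meson card_image_le card_mono finite_atLeastLessThan finite_imageI le_trans)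
    moreover have "len \<beta> \<noteq> 0" using wt False by (auto simp: len_def)
    ultimately show ?thesis using False by auto
  qed simp
  moreover have "0 \<notin> set (parts \<beta>)" using parts[of \<beta>] by simp
  ultimately have rep: "parts \<beta> = replicate (length (parts \<beta>)) 1"
    and "length (parts \<beta>) \<le> i"
    using eq[of "parts \<beta>"] ge[of "parts \<beta>"] unfolding wt len_def by blast+
  with \<open>i \<le> len \<beta>\<close> have "length (parts \<beta>) = i" by (simp add: len_def)
  with rep show "\<beta> = ones i" by (simp add: ones.rep_eq flip: parts_inject)
qed (simp add: refines_def)

lemma F_ones: "F (ones i) = (\<lambda>m. if flat m = ones i then 1 else 0)"
  by (simp add: F_def refines_ones M_eq_flat)

section \<open>Linearity and coefficients of the adjoints\<close>

lemma pairing_superset: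
  assumes "finite S" "Poly_Mapping.keys X \<subseteq> S"
  shows "pairing X E = (\<Sum>\<alpha>\<in>S. Poly_Mapping.lookup X \<alpha> * M_coeff E \<alpha>)"
  unfolding pairing_def using assms by (intro sum.mono_neutral_left) (auto simp: in_keys_iff)

lemma pairing_add: "pairing (X + Y) E = pairing X E + pairing Y E"
proof -
  let ?S = "Poly_Mapping.keys X \<union> Poly_Mapping.keys Y"
  have "Poly_Mapping.keys (X + Y) \<subseteq> ?S" by (rule keys_add)
  then show ?thesis
    by (simp add: pairing_superset[of ?S] lookup_add distrib_right sum.distrib)
qed

lemma lookup_perp: "Poly_Mapping.lookup (perp G X) \<gamma> = pairing X (series_mult G (M \<gamma>))"
  using perp_pairing[OF M_in_QSym] by (simp add: pairing_M)

lemma perp_add: "perp G (X + Y) = perp G X + perp G Y"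
  by (rule poly_mapping_eqI) (simp add: lookup_perp lookup_add pairing_add)

lemma perp_zero: "perp G 0 = 0"
  by (rule poly_mapping_eqI) (simp add: lookup_perp pairing_def)

definition splittings :: "monomial \<Rightarrow> (monomial \<times> monomial) set" where
  "splittings m = {(a, b). a + b = m}"

text \<open>The pairing with the basis element of \<alpha> reads one coefficient of
  \<open>series_mult G (M \<gamma>)\<close>. That coefficient is a sum over splittings, in which the
  factor read by \<open>M \<gamma>\<close> only counts when it flattens to \<gamma>.\<close>

lemma perp_single:
  "perp G (Poly_Mapping.single \<alpha> c) =
    (\<Sum>(a, b)\<in>splittings (monomial_of [0..<len \<alpha>] (parts \<alpha>)). Poly_Mapping.single (flat b) (c * G a))"
proof (rule poly_mapping_eqI)
  fix \<gamma>
  have "pairing (Poly_Mapping.single \<alpha> c) E = c * M_coeff E \<alpha>" for E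
    by (subst pairing_superset[of "{\<alpha>}"]) auto
  then show "Poly_Mapping.lookup (perp G (Poly_Mapping.single \<alpha> c)) \<gamma> = Poly_Mapping.lookup
     (\<Sum>(a, b)\<in>splittings (monomial_of [0..<len \<alpha>] (parts \<alpha>)). Poly_Mapping.single (flat b) (c * G a)) \<gamma>"
    by (auto simp: lookup_perp M_coeff_def series_mult_def splittings_def M_eq_flat lookup_sum
        lookup_single when_def sum_distrib_left case_prod_unfold intro!: sum.cong)
qed

lemma monomial_of_add_comp1:
  "monomial_of [0..<len (\<alpha> + comp1 s)] (parts (\<alpha> + comp1 s)) =
    monomial_of [0..<len \<alpha>] (parts \<alpha>) + Poly_Mapping.single (len \<alpha>) s"
  by (simp add: monomial_of_def len_def plus_composition.rep_eq parts_comp1 zip_append)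

lemma keys_splittings:
  assumes "(a, b) \<in> splittings m"
  shows "Poly_Mapping.keys a \<subseteq> Poly_Mapping.keys m" "Poly_Mapping.keys b \<subseteq> Poly_Mapping.keys m"
  using assms by (auto simp: splittings_def in_keys_iff lookup_add)

text \<open>The exponent \<open>s\<close> of the fresh variable \<open>n\<close> is divided between
  the two factors as \<open>t\<close> and \<open>s - t\<close>, independently of how
  \<open>m\<close> is split.\<close>

lemma splittings_add_single:
  assumes n: "n \<notin> Poly_Mapping.keys m"
  shows "bij_betw (\<lambda>((a, b), t). (a + Poly_Mapping.single n t, b + Poly_Mapping.single n (s - t)))
    (splittings m \<times> {..s}) (splittings (m + Poly_Mapping.single n s))"
proof -
  have l0: "Poly_Mapping.lookup a n = 0" "Poly_Mapping.lookup b n = 0" if "(a, b) \<in> splittings m" for a b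
    using that n by (auto simp: splittings_def in_keys_iff lookup_add)
  define f where "f = (\<lambda>((a :: monomial, b :: monomial), t). (a + Poly_Mapping.single n t, b + Poly_Mapping.single n (s - t)))"
  \<comment> \<open>The inverse reads \<open>t\<close> off the first factor and erases
    \<open>n\<close> from both factors.\<close>
  define g where "g = (\<lambda>(x :: monomial, y :: monomial). ((Poly_Mapping.update n 0 x, Poly_Mapping.update n 0 y), Poly_Mapping.lookup x n))"
  have f: "f ((a, b), t) = (a + Poly_Mapping.single n t, b + Poly_Mapping.single n (s - t))" for a b t
    by (simp add: f_def)
  have g: "g (x, y) = ((Poly_Mapping.update n 0 x, Poly_Mapping.update n 0 y), Poly_Mapping.lookup x n)" for x y
    by (simp add: g_def)
  have upd: "Poly_Mapping.update n 0 (a + Poly_Mapping.single n t) = a"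
    if "Poly_Mapping.lookup a n = 0" for a :: monomial and t
  proof (rule poly_mapping_eqI)
    fix j
    show "Poly_Mapping.lookup (Poly_Mapping.update n 0 (a + Poly_Mapping.single n t)) j = Poly_Mapping.lookup a j"
      using that by (cases "n = j") (simp_all add: lookup_update lookup_add lookup_single_not_eq)
  qed
  have upd': "Poly_Mapping.update n 0 x + Poly_Mapping.single n (Poly_Mapping.lookup x n) = x" for x :: monomial
  proof (rule poly_mapping_eqI)
    fix j
    show "Poly_Mapping.lookup (Poly_Mapping.update n 0 x + Poly_Mapping.single n (Poly_Mapping.lookup x n)) j
        = Poly_Mapping.lookup x j"
      by (cases "n = j") (simp_all add: lookup_update lookup_add lookup_single)
  qed
  have ys: "Poly_Mapping.lookup x n + Poly_Mapping.lookup y n = s" "Poly_Mapping.update n 0 x + Poly_Mapping.update n 0 y = m"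
    if "(x, y) \<in> splittings (m + Poly_Mapping.single n s)" for x y
  proof -
    from that have xy: "x + y = m + Poly_Mapping.single n s" by (simp add: splittings_def)
    have l: "Poly_Mapping.lookup x j + Poly_Mapping.lookup y j = Poly_Mapping.lookup m j + (s when n = j)" for j
      using arg_cong[OF xy, of "\<lambda>z. Poly_Mapping.lookup z j"] by (simp add: lookup_add lookup_single)
    show "Poly_Mapping.lookup x n + Poly_Mapping.lookup y n = s"
      using l[of n] n by (simp add: in_keys_iff)
    show "Poly_Mapping.update n 0 x + Poly_Mapping.update n 0 y = m"
    proof (rule poly_mapping_eqI)
      fix j
      show "Poly_Mapping.lookup (Poly_Mapping.update n 0 x + Poly_Mapping.update n 0 y) j = Poly_Mapping.lookup m j"
        using l[of j] n by (cases "n = j") (simp_all add: lookup_update lookup_add in_keys_iff)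
    qed
  qed
  have "bij_betw f (splittings m \<times> {..s}) (splittings (m + Poly_Mapping.single n s))"
  proof (rule bij_betw_byWitness[where f' = g])
    show "\<forall>p\<in>splittings m \<times> {..s}. g (f p) = p"
    proof
      fix p assume p: "p \<in> splittings m \<times> {..s}"
      obtain a b t where abt: "p = ((a, b), t)" by (metis surj_pair)
      have "Poly_Mapping.lookup a n = 0" "Poly_Mapping.lookup b n = 0"
        using p unfolding abt by (auto intro: l0)
      then show "g (f p) = p" unfolding abt f g by (simp add: upd lookup_add)
    qed
    show "\<forall>p\<in>splittings (m + Poly_Mapping.single n s). f (g p) = p"
    proof
      fix p assume p: "p \<in> splittings (m + Poly_Mapping.single n s)"
      obtain x y where xy: "p = (x, y)" by (metis surj_pair)
      have "s - Poly_Mapping.lookup x n = Poly_Mapping.lookup y n"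
        using ys(1)[OF p[unfolded xy]] by linarith
      then show "f (g p) = p" unfolding xy f g by (simp only: upd')
    qed
    show "f ` (splittings m \<times> {..s}) \<subseteq> splittings (m + Poly_Mapping.single n s)"
    proof (rule image_subsetI)
      fix p assume p: "p \<in> splittings m \<times> {..s}"
      obtain a b t where abt: "p = ((a, b), t)" by (metis surj_pair)
      have ab: "a + b = m" and t: "t \<le> s" using p unfolding abt by (simp_all add: splittings_def)
      have "(a + Poly_Mapping.single n t) + (b + Poly_Mapping.single n (s - t))
          = a + b + (Poly_Mapping.single n t + Poly_Mapping.single n (s - t))"
        by (simp only: ac_simps)
      also have "Poly_Mapping.single n t + Poly_Mapping.single n (s - t) = Poly_Mapping.single n s"
        using t by (simp flip: single_add)
      finally have "(a + Poly_Mapping.single n t) + (b + Poly_Mapping.single n (s - t)) = m + Poly_Mapping.single n s"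
        unfolding ab .
      then show "f p \<in> splittings (m + Poly_Mapping.single n s)"
        unfolding abt f splittings_def by simp
    qed
    show "g ` splittings (m + Poly_Mapping.single n s) \<subseteq> splittings m \<times> {..s}"
    proof (rule image_subsetI)
      fix p assume p: "p \<in> splittings (m + Poly_Mapping.single n s)"
      obtain x y where xy: "p = (x, y)" by (metis surj_pair)
      show "g p \<in> splittings m \<times> {..s}"
        using ys[OF p[unfolded xy]] unfolding xy g splittings_def by simp
    qed
  qed
  then show ?thesis unfolding f_def .
qed

text \<open>The combinatorial source of the two Leibniz terms: a column either lacks the last
  variable or uses it with exponent 1.\<close>

lemma add_comp1_eq_ones:
  "\<alpha> + comp1 t = ones i \<longleftrightarrow> (t = 0 \<and> \<alpha> = ones i) \<or> (t = 1 \<and> i > 0 \<and> \<alpha> = ones (i - 1))"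
proof (cases i)
  case (Suc j)
  have "replicate (Suc j) 1 = replicate j 1 @ [1::nat]" by (simp flip: replicate_append_same)
  then show ?thesis using Suc
    by (auto simp: plus_composition.rep_eq parts_comp1 ones.rep_eq simp del: replicate_Suc simp flip: parts_inject)
qed (auto simp: plus_composition.rep_eq parts_comp1 ones.rep_eq simp flip: parts_inject)

text \<open>
  The monomial of \<open>\<alpha> + comp1 s\<close> has one more variable than that of \<open>\<alpha>\<close>; in a splitting, the factor
  read by \<open>F\<^bsub>1^i\<^esub>\<close> takes exponent 0 or 1 of it, which gives the two terms.
\<close>

lemma perp_mult_H:
  "perp (F (ones i)) (X * H (int s)) =
    perp (F (ones i)) X * H (int s) + (if i = 0 then 0 else perp (F (ones (i - 1))) X * H (int s - 1))"
  (is "?L X = ?R X")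
proof -
  have single: "?L (Poly_Mapping.single \<alpha> c) = ?R (Poly_Mapping.single \<alpha> c)" for \<alpha> c
  proof -
    let ?n = "len \<alpha>"
    let ?m = "monomial_of [0..<?n] (parts \<alpha>)"
    let ?e = "\<lambda>i a. if flat a = ones i then 1 else (0::rat)"
    have sub: "Poly_Mapping.keys ?m \<subseteq> {..<?n}"
      using lookup_monomial_of_notin[of _ "[0..<?n]" "parts \<alpha>"] by (force simp: in_keys_iff)
    then have notin: "?n \<notin> Poly_Mapping.keys ?m" by auto
    have keys: "Poly_Mapping.keys a \<subseteq> {..<?n}" "Poly_Mapping.keys b \<subseteq> {..<?n}"
      if "(a, b) \<in> splittings ?m" for a b
      using keys_splittings[OF that] sub by blast+
    \<comment> \<open>For \<open>s = 0\<close> the truncated \<open>s - 1\<close> would give the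
      wrong composition; the term has to vanish there because \<open>H (-1) = 0\<close>.\<close>
    have H1: "(if s = 0 then 0 else Poly_Mapping.single (comp1 (s - 1)) 1) = H (int s - 1)"
      by (cases s) (simp_all add: H_def[of "-1"] flip: H_of_nat)
    have inner: "(\<Sum>t\<le>s. Poly_Mapping.single (flat b + comp1 (s - t)) (c * ?e i (a + Poly_Mapping.single ?n t)))
        = Poly_Mapping.single (flat b) (c * ?e i a) * H (int s) +
          (if i = 0 then 0 else Poly_Mapping.single (flat b) (c * ?e (i - 1) a) * H (int s - 1))"
      (is "?l = ?r") if ab: "(a, b) \<in> splittings ?m" for a b
    proof -
      have e: "?e i (a + Poly_Mapping.single ?n t) = (if t = 0 then ?e i a else if t = 1 \<and> i > 0 then ?e (i - 1) a else 0)" for t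
        by (simp add: flat_add_single[OF keys(1)[OF ab]] add_comp1_eq_ones)
      have "?l = (\<Sum>t\<in>{..s} \<inter> {0,1}. Poly_Mapping.single (flat b + comp1 (s - t)) (c * ?e i (a + Poly_Mapping.single ?n t)))"
        by (rule sum.mono_neutral_right) (auto simp: e)
      also have "\<dots> = Poly_Mapping.single (flat b + comp1 s) (c * ?e i a) +
          (if s = 0 \<or> i = 0 then 0 else Poly_Mapping.single (flat b + comp1 (s - 1)) (c * ?e (i - 1) a))"
      proof -
        have "{..s} \<inter> {0,1} = (if s = 0 then {0} else {0,1})" by auto
        then show ?thesis unfolding e by auto
      qed
      also have "\<dots> = ?r" unfolding H1[symmetric] by (simp add: H_of_nat mult_single)
      finally show ?thesis .
    qed
    have "?L (Poly_Mapping.single \<alpha> c) = perp (F (ones i)) (Poly_Mapping.single (\<alpha> + comp1 s) c)"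
      by (simp add: H_of_nat mult_single)
    also have "\<dots> = (\<Sum>(a, b)\<in>splittings (?m + Poly_Mapping.single ?n s). Poly_Mapping.single (flat b) (c * ?e i a))"
      by (simp only: perp_single monomial_of_add_comp1 F_ones)
    also have "\<dots> = (\<Sum>(p, t)\<in>splittings ?m \<times> {..s}.
        Poly_Mapping.single (flat (snd p + Poly_Mapping.single ?n (s - t))) (c * ?e i (fst p + Poly_Mapping.single ?n t)))"
      by (subst sum.reindex_bij_betw[OF splittings_add_single[OF notin], symmetric])
         (simp add: case_prod_unfold)
    also have "\<dots> = (\<Sum>p\<in>splittings ?m. \<Sum>t\<le>s.
        Poly_Mapping.single (flat (snd p + Poly_Mapping.single ?n (s - t))) (c * ?e i (fst p + Poly_Mapping.single ?n t)))"
      by (simp add: sum.cartesian_product)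
    also have "\<dots> = (\<Sum>p\<in>splittings ?m. Poly_Mapping.single (flat (snd p)) (c * ?e i (fst p)) * H (int s) +
          (if i = 0 then 0 else Poly_Mapping.single (flat (snd p)) (c * ?e (i - 1) (fst p)) * H (int s - 1)))"
    proof (rule sum.cong[OF refl])
      fix p assume "p \<in> splittings ?m"
      then have p: "(fst p, snd p) \<in> splittings ?m" by simp
      show "(\<Sum>t\<le>s. Poly_Mapping.single (flat (snd p + Poly_Mapping.single ?n (s - t))) (c * ?e i (fst p + Poly_Mapping.single ?n t)))
        = Poly_Mapping.single (flat (snd p)) (c * ?e i (fst p)) * H (int s) +
          (if i = 0 then 0 else Poly_Mapping.single (flat (snd p)) (c * ?e (i - 1) (fst p)) * H (int s - 1))"
        using inner[OF p] by (simp only: flat_add_single[OF keys(2)[OF p]])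
    qed
    also have "\<dots> = ?R (Poly_Mapping.single \<alpha> c)"
      by (simp add: perp_single F_ones case_prod_unfold sum.distrib sum_distrib_right)
    finally show ?thesis .
  qed
  \<comment> \<open>Both sides are additive in \<open>X\<close>, so the basis case extends to finite
    sums of monomials, hence to every \<open>X\<close>.\<close>
  have sum: "?L (\<Sum>\<alpha>\<in>A. Poly_Mapping.single \<alpha> (f \<alpha>)) = ?R (\<Sum>\<alpha>\<in>A. Poly_Mapping.single \<alpha> (f \<alpha>))" 
    if "finite A" for A f using that
  proof (induction A rule: finite_induct)
    case (insert x A)
    then show ?case using single[of x "f x"] by (auto simp: perp_add distrib_right)
  qed (simp add: perp_zero)
  from sum[OF finite_keys[of X], of "Poly_Mapping.lookup X"] show ?thesis
    unfolding sum_monomials[symmetric] .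
qed

text \<open>The monomial 1 splits only trivially, so the adjoint applied to 1 reads off the constant
  term.\<close>

lemma perp_one: "perp (F (ones i)) 1 = (if i = 0 then 1 else 0)"
proof -
  have "splittings 0 = {(0, 0)}"
    by (auto simp: splittings_def poly_mapping_eq_iff fun_eq_iff lookup_add)
  moreover have "0 = ones i \<longleftrightarrow> i = 0"
    by (auto simp: zero_composition.rep_eq ones.rep_eq simp flip: parts_inject)
  ultimately show ?thesis
    using perp_single[of "F (ones i)" 0 1]
    by (simp add: monomial_of_def zero_composition.rep_eq len_def F_ones flat_zero)
qed

text \<open>A basis element involves finitely many splittings, so the lengths of the flattened first
  factors are bounded, and longer columns match none of them. This makes the series defining
  \<open>B\<close> finite.\<close>

lemma perp_ones_vanishes: "\<exists>N. \<forall>i\<ge>N. perp (F (ones i)) X = 0"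
proof -
  have single: "\<exists>N. \<forall>i\<ge>N. perp (F (ones i)) (Poly_Mapping.single \<alpha> c) = 0" for \<alpha> c
  proof -
    let ?S = "splittings (monomial_of [0..<len \<alpha>] (parts \<alpha>))"
    have fin: "finite ?S" unfolding splittings_def by (rule finite_splittings)
    have "flat (fst p) \<noteq> ones i" if "p \<in> ?S" "Suc (Max ((\<lambda>p. len (flat (fst p))) ` ?S)) \<le> i" for p i
    proof
      assume eq: "flat (fst p) = ones i"
      have "len (flat (fst p)) \<le> Max ((\<lambda>p. len (flat (fst p))) ` ?S)"
        using fin that by (intro Max_ge) auto
      then show False using that eq by (simp add: len_def ones.rep_eq)
    qed
    then show ?thesis
      by (intro exI[of _ "Suc (Max ((\<lambda>p. len (flat (fst p))) ` ?S))"])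
         (auto simp: perp_single F_ones case_prod_unfold intro!: sum.neutral)
  qed
  have sum: "\<exists>N. \<forall>i\<ge>N. perp (F (ones i)) (\<Sum>\<alpha>\<in>A. Poly_Mapping.single \<alpha> (f \<alpha>)) = 0" 
    if "finite A" for A f using that
  proof (induction A rule: finite_induct)
    case (insert x A)
    then obtain N where N: "\<forall>i\<ge>N. perp (F (ones i)) (\<Sum>\<alpha>\<in>A. Poly_Mapping.single \<alpha> (f \<alpha>)) = 0" by blast
    obtain N' where N': "\<forall>i\<ge>N'. perp (F (ones i)) (Poly_Mapping.single x (f x)) = 0" using single by blast
    show ?case using N N' insert by (intro exI[of _ "max N N'"]) (simp add: perp_add)
  qed (simp add: perp_zero)
  from sum[OF finite_keys[of X], of "Poly_Mapping.lookup X"] show ?thesis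
    unfolding sum_monomials[symmetric] .
qed

section \<open>The right Pieri rule\<close>

text \<open>The cutoff \<open>N\<close> is free, so that several applications of \<open>B\<close>
  can be compared over one range.\<close>

lemma B_eq_sum:
  assumes "\<And>i. i \<ge> N \<Longrightarrow> perp (F (ones i)) X = 0"
  shows "B m X = (\<Sum>i<N. (-1) ^ i * H (m + int i) * perp (F (ones i)) X)"
  unfolding B_def
proof (rule Sum_any.expand_superset)
  show "{i. (-1) ^ i * H (m + int i) * perp (F (ones i)) X \<noteq> 0} \<subseteq> {..<N}"
  proof
    fix i assume i: "i \<in> {i. (-1) ^ i * H (m + int i) * perp (F (ones i)) X \<noteq> 0}"
    show "i \<in> {..<N}"
    proof (rule ccontr)
      assume "i \<notin> {..<N}"
      then have "perp (F (ones i)) X = 0" using assms by simp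
      with i show False by simp
    qed
  qed
qed simp

lemma B_add: "B m (X + Y) = B m X + B m Y"
proof -
  obtain N where N: "\<forall>i\<ge>N. perp (F (ones i)) X = 0" using perp_ones_vanishes by blast
  obtain N' where N': "\<forall>i\<ge>N'. perp (F (ones i)) Y = 0" using perp_ones_vanishes by blast
  show ?thesis using N N'
    by (simp add: B_eq_sum[where N = "max N N'"] perp_add distrib_left sum.distrib)
qed

lemma B_zero: "B m 0 = 0"
  by (simp add: B_eq_sum[where N = 0] perp_zero)

lemma B_sum: "B m (\<Sum>x\<in>A. f x) = (\<Sum>x\<in>A. B m (f x))"
  by (induction A rule: infinite_finite_induct) (simp_all add: B_zero B_add)

lemma B_one: "B m 1 = H m"
  by (simp add: B_eq_sum[where N = 1] perp_one)

text \<open>The Leibniz rule splits the sum in two. The identity is stated without subtraction and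
  covers \<open>s = 0\<close>, where \<open>H (-1) = 0\<close>.\<close>

lemma B_mult_H: "B m (X * H (int s)) + B (m + 1) X * H (int s - 1) = B m X * H (int s)"
proof -
  obtain N where N: "\<forall>i\<ge>N. perp (F (ones i)) X = 0" using perp_ones_vanishes by blast
  let ?p = "\<lambda>i. perp (F (ones i)) X"
  \<comment> \<open>The cutoff grows by one: at \<open>i = N\<close> the Leibniz rule still involves
    the column of length \<open>N - 1\<close>.\<close>
  have "B m (X * H (int s)) = (\<Sum>i<Suc N. (-1) ^ i * H (m + int i) * perp (F (ones i)) (X * H (int s)))"
    using N by (intro B_eq_sum) (simp add: perp_mult_H)
  also have "\<dots> = (\<Sum>i<Suc N. (-1) ^ i * H (m + int i) * (?p i * H (int s))) +
     (\<Sum>i<Suc N. (-1) ^ i * H (m + int i) * (if i = 0 then 0 else ?p (i - 1) * H (int s - 1)))"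
    by (simp only: perp_mult_H distrib_left sum.distrib)
  also have "(\<Sum>i<Suc N. (-1) ^ i * H (m + int i) * (?p i * H (int s))) = B m X * H (int s)"
    using N by (simp add: B_eq_sum[where N = "Suc N"] sum_distrib_right mult.assoc)
  \<comment> \<open>The term at 0 is zero; shifting \<open>i\<close> by one flips the sign and moves
    the 1 into the index \<open>m + 1\<close>.\<close>
  also have "(\<Sum>i<Suc N. (-1) ^ i * H (m + int i) * (if i = 0 then 0 else ?p (i - 1) * H (int s - 1)))
     = (\<Sum>i<N. - ((-1) ^ i * H (m + 1 + int i) * (?p i * H (int s - 1))))"
    by (simp add: sum.lessThan_Suc_shift add.assoc del: sum.lessThan_Suc)
  also have "\<dots> = - (B (m + 1) X * H (int s - 1))"
    using N by (simp add: B_eq_sum[where N = N] sum_distrib_right mult.assoc sum_negf)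
  finally show ?thesis by simp
qed

text \<open>Iterate \<open>B_mult_H\<close>. The induction keeps \<open>m\<close> arbitrary because
  the correction term has \<open>m + 1\<close> in place of \<open>m\<close>.\<close>

lemma B_times_H: "B m X * H (int s) = (\<Sum>k\<le>s. B (m + int k) (X * H (int (s - k))))"
proof (induction s arbitrary: m)
  case 0
  then show ?case by (simp add: H_def)
next
  case (Suc s)
  have "B m X * H (int (Suc s)) = B m (X * H (int (Suc s))) + B (m + 1) X * H (int s)"
    using B_mult_H[of m X "Suc s"] by simp
  then show ?case unfolding Suc
    by (simp add: sum.atMost_Suc_shift add.assoc del: sum.atMost_Suc)
qed


section \<open>Right multiplication as adding boxes to rows\<close>

lemma immaculate_simps: "immaculate [] = 1" "immaculate (a # as) = B a (immaculate as)"
  by (simp_all add: immaculate_def)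

text \<open>The recursion follows \<open>B_times_H\<close>: \<open>k\<close> copies of
  \<open>n\<close> go to the first row and the rest further down. When no copies are left, no new
  row is created, so rows stay nonempty and shapes stay compositions.\<close>

fun add_entries :: "nat \<Rightarrow> nat \<Rightarrow> nat list list \<Rightarrow> nat list list set" where
  "add_entries n s [] = {if s = 0 then [] else [replicate s n]}"
| "add_entries n s (r # T) = (\<Union>k\<le>s. (#) (r @ replicate k n) ` add_entries n (s - k) T)"

lemma finite_add_entries: "finite (add_entries n s T)"
  by (induction T arbitrary: s) auto

text \<open>Only row lengths matter here, so \<open>n\<close> is arbitrary and \<open>T\<close> can
  be any list of rows. At the bottom, \<open>B s 1 = H s\<close> produces the new row.\<close>

lemma immaculate_times_H:
  "immaculate (map int (map length T)) * H (int s) =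
    (\<Sum>T'\<in>add_entries n s T. immaculate (map int (map length T')))"
proof (induction T arbitrary: s)
  case Nil
  then show ?case by (cases "s = 0") (simp_all add: immaculate_simps B_one H_def)
next
  case (Cons r T)
  let ?im = "\<lambda>T. immaculate (map int (map length T))"
  have "?im (r # T) * H (int s) = (\<Sum>k\<le>s. B (int (length r + k)) (?im T * H (int (s - k))))"
    by (simp add: immaculate_simps B_times_H)
  also have "\<dots> = (\<Sum>k\<le>s. \<Sum>T'\<in>add_entries n (s - k) T. B (int (length r + k)) (?im T'))"
    by (simp only: Cons.IH B_sum)
  also have "\<dots> = (\<Sum>k\<le>s. \<Sum>T'\<in>(#) (r @ replicate k n) ` add_entries n (s - k) T. ?im T')"
    by (simp add: sum.reindex immaculate_simps)
  also have "\<dots> = (\<Sum>T'\<in>add_entries n s (r # T). ?im T')"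
    unfolding add_entries.simps
    \<comment> \<open>Different \<open>k\<close> give first rows of different lengths.\<close>
    by (rule sum.UNION_disjoint[symmetric]) (auto simp: finite_add_entries)
  finally show ?case .
qed

section \<open>Growth of immaculate tableaux\<close>

text \<open>A left inverse of \<open>add_entries\<close>; empty rows are dropped so that a new row
  filled with \<open>n\<close> disappears.\<close>

definition restrict_below :: "nat \<Rightarrow> nat list list \<Rightarrow> nat list list" where
  "restrict_below n T = filter (\<lambda>r. r \<noteq> []) (map (filter (\<lambda>x. x < n)) T)"

lemma restrict_below_add_entries:
  assumes "T' \<in> add_entries n s T" "\<forall>r\<in>set T. r \<noteq> [] \<and> (\<forall>x\<in>set r. x < n)"
  shows "restrict_below n T' = T"
  using assms
proof (induction T arbitrary: s T')
  case (Cons r T)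
  then obtain k T'' where "T'' \<in> add_entries n (s - k) T" "T' = (r @ replicate k n) # T''" by auto
  moreover have "filter (\<lambda>x. x < n) r = r" using Cons.prems by simp
  ultimately show ?case using Cons.IH[of T''] Cons.prems by (simp add: restrict_below_def)
qed (auto simp: restrict_below_def split: if_splits)

text \<open>Shape and content are left free. Nonempty rows make \<open>hd\<close> meaningful and the
  row lengths a composition.\<close>

definition immaculate_filling :: "nat list list \<Rightarrow> bool" where
  "immaculate_filling T \<longleftrightarrow>
    (\<forall>r\<in>set T. r \<noteq> [] \<and> 0 \<notin> set r \<and> sorted r) \<and> sorted_wrt (<) (map hd T)"

lemma count_list_replicate: "count_list (replicate k n) i = (if i = n then k else 0)"
  by (induction k) auto

lemma count_list_add_entries:
  "T' \<in> add_entries n s T \<Longrightarrow>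
    count_list (concat T') i = count_list (concat T) i + (if i = n then s else 0)"
proof (induction T arbitrary: s T')
  case (Cons r T)
  then obtain k T'' where "k \<le> s" "T'' \<in> add_entries n (s - k) T" "T' = (r @ replicate k n) # T''" by auto
  then show ?case using Cons.IH[of T''] by (simp add: count_list_replicate)
qed (auto simp: count_list_replicate)

lemma sum_length_add_entries:
  "T' \<in> add_entries n s T \<Longrightarrow> sum_list (map length T') = sum_list (map length T) + s"
proof (induction T arbitrary: s T')
  case (Cons r T)
  then obtain k T'' where "k \<le> s" "T'' \<in> add_entries n (s - k) T" "T' = (r @ replicate k n) # T''" by auto
  then show ?case using Cons.IH[of T''] by simp
qed auto

text \<open>Old heads survive and a new row starts with \<open>n\<close>, which exceeds all old
  entries. The bound on the heads is what the induction needs to compare the first row with the rows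
  below it.\<close>

lemma immaculate_filling_add_entries:
  assumes "T' \<in> add_entries n s T" "immaculate_filling T" "\<forall>r\<in>set T. \<forall>x\<in>set r. x < n" "n > 0"
  shows "immaculate_filling T' \<and> hd ` set T' \<subseteq> insert n (hd ` set T)"
  using assms
proof (induction T arbitrary: s T')
  case Nil
  then show ?case by (cases s) (auto simp: immaculate_filling_def)
next
  case (Cons r T)
  then obtain k T'' where T'': "T'' \<in> add_entries n (s - k) T" "T' = (r @ replicate k n) # T''" by auto
  have T: "immaculate_filling T" using Cons.prems(2) by (simp add: immaculate_filling_def)
  have IH: "immaculate_filling T''" "hd ` set T'' \<subseteq> insert n (hd ` set T)"
    using Cons.IH[OF T''(1) T] Cons.prems by auto
  have r: "r \<noteq> []" "0 \<notin> set r" "sorted r" "\<forall>x\<in>set r. x < n" "\<forall>t\<in>set T. hd r < hd t"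
    using Cons.prems by (auto simp: immaculate_filling_def)
  have hd: "hd (r @ replicate k n) = hd r" "hd r < n" using r by auto
  have "\<forall>t\<in>set T''. hd r < hd t" using IH(2) r(5) hd(2) by fastforce
  moreover have "sorted (r @ replicate k n)"
    using r by (auto simp: sorted_append less_imp_le)
  ultimately show ?case using IH r hd Cons.prems(4)
    by (auto simp: T'' immaculate_filling_def)
qed

lemma sorted_filter_replicate:
  assumes "sorted r" "\<forall>x\<in>set r. x \<le> (n::nat)"
  shows "r = filter (\<lambda>x. x < n) r @ replicate (count_list r n) n"
  using assms
proof (induction r)
  case (Cons x r)
  show ?case
  proof (cases "x = n")
    case True
    then have "\<forall>y\<in>set r. y = n" using Cons.prems by (auto intro: antisym)
    then have "filter (\<lambda>x. x < n) r = []" by (auto simp: filter_empty_conv)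
    then show ?thesis using True Cons by simp
  next
    case False
    then show ?thesis using Cons by simp
  qed
qed simp

lemma hd_filter_below: "sorted r \<Longrightarrow> filter (\<lambda>x. x < (n::nat)) r \<noteq> [] \<Longrightarrow> hd (filter (\<lambda>x. x < n) r) = hd r"
  by (cases r) (auto simp: filter_empty_conv split: if_splits dest: le_less_trans)

text \<open>Conversely, every tableau arises by adding its largest entries: in a sorted row the
  copies of \<open>n\<close> form the end, and only the last row can consist of them alone. The
  claim about heads again serves the induction.\<close>

lemma immaculate_filling_restrict:
  assumes "immaculate_filling T" "\<forall>r\<in>set T. \<forall>x\<in>set r. x \<le> n"
  shows "T \<in> add_entries n (count_list (concat T) n) (restrict_below n T)
    \<and> immaculate_filling (restrict_below n T)
    \<and> hd ` set (restrict_below n T) \<subseteq> hd ` set T"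
  using assms
proof (induction T)
  case (Cons r T)
  have T: "immaculate_filling T" using Cons.prems(1) by (simp add: immaculate_filling_def)
  have IH: "T \<in> add_entries n (count_list (concat T) n) (restrict_below n T)"
    "immaculate_filling (restrict_below n T)" "hd ` set (restrict_below n T) \<subseteq> hd ` set T"
    using Cons.IH[OF T] Cons.prems by auto
  have r: "r \<noteq> []" "0 \<notin> set r" "sorted r" "\<forall>x\<in>set r. x \<le> n" "\<forall>t\<in>set T. hd r < hd t"
    using Cons.prems by (auto simp: immaculate_filling_def)
  have eq: "r = filter (\<lambda>x. x < n) r @ replicate (count_list r n) n"
    using r by (intro sorted_filter_replicate)
  show ?case
  proof (cases "filter (\<lambda>x. x < n) r = []")
    case True
    have rep: "r = replicate (count_list r n) n" using eq True by simp
    then have c: "count_list r n \<noteq> 0" using r(1) by (metis replicate_0)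
    have "hd r = n" using rep c by (metis hd_replicate)
    \<comment> \<open>A row below one that starts with \<open>n\<close> would have to start with a
      larger entry.\<close>
    have "T = []"
    proof (rule ccontr)
      assume "T \<noteq> []"
      then obtain t where t: "t \<in> set T" by (meson last_in_set)
      then have "t \<noteq> []" using T by (auto simp: immaculate_filling_def)
      then have "hd t \<le> n" using Cons.prems(2) t by simp
      then show False using r(5) t \<open>hd r = n\<close> by fastforce
    qed
    then show ?thesis using True c rep by (simp add: restrict_below_def immaculate_filling_def)
  next
    case False
    have res: "restrict_below n (r # T) = filter (\<lambda>x. x < n) r # restrict_below n T"
      using False by (simp add: restrict_below_def)
    have hd: "hd (filter (\<lambda>x. x < n) r) = hd r" using r(3) False by (rule hd_filter_below)
    have "r # T \<in> add_entries n (count_list (concat (r # T)) n) (filter (\<lambda>x. x < n) r # restrict_below n T)"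
      unfolding add_entries.simps
    proof (rule UN_I[of "count_list r n"])
      show "r # T \<in> (#) (filter (\<lambda>x. x < n) r @ replicate (count_list r n) n) `
          add_entries n (count_list (concat (r # T)) n - count_list r n) (restrict_below n T)"
        using IH(1) eq by (intro image_eqI[of _ _ T]) simp_all
    qed simp
    moreover have "\<forall>t\<in>set (restrict_below n T). hd r < hd t" using IH(3) r(5) by fastforce
    ultimately show ?thesis unfolding res
      using IH(2,3) r hd False by (auto simp: immaculate_filling_def sorted_wrt_filter)
  qed
qed (simp add: restrict_below_def immaculate_filling_def)

section \<open>Tableaux of a given content\<close>

lemma count_list_filter: "count_list (filter P xs) i = (if P i then count_list xs i else 0)"
  by (induction xs) auto

lemma count_list_restrict_below:
  "count_list (concat (restrict_below n T)) i = (if i < n then count_list (concat T) i else 0)"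
  by (induction T) (auto simp: restrict_below_def count_list_filter filter_empty_conv count_list_0_iff)

text \<open>All shapes are taken together and the content is a bare list, so that one can induct on
  its last part.\<close>

definition tableaux_of_content :: "nat list \<Rightarrow> nat list list set" where
  "tableaux_of_content bs = {T. immaculate_filling T
     \<and> (\<forall>i\<ge>1. count_list (concat T) i = (if i \<le> length bs then bs ! (i - 1) else 0))}"

lemma tableaux_of_content_entry_le:
  assumes "T \<in> tableaux_of_content bs" "r \<in> set T" "x \<in> set r"
  shows "x \<le> length bs"
proof (rule ccontr)
  assume "\<not> x \<le> length bs"
  then have "count_list (concat T) x = 0" using assms(1) by (simp add: tableaux_of_content_def)
  then show False using assms by (auto simp: count_list_0_iff)
qed

lemma tableaux_of_content_Nil: "tableaux_of_content [] = {[]}"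
proof
  show "tableaux_of_content [] \<subseteq> {[]}"
  proof
    fix T assume T: "T \<in> tableaux_of_content []"
    have "False" if "r \<in> set T" for r
    proof -
      have "r \<noteq> []" "0 \<notin> set r" using T that by (auto simp: tableaux_of_content_def immaculate_filling_def)
      then show False using tableaux_of_content_entry_le[OF T that, of "hd r"] by (cases r) auto
    qed
    then show "T \<in> {[]}" by (cases T) auto
  qed
qed (simp add: tableaux_of_content_def immaculate_filling_def)

text \<open>The last part of the content counts the largest entry: restriction removes it and
  \<open>add_entries\<close> restores it.\<close>

lemma tableaux_of_content_snoc:
  "tableaux_of_content (bs @ [s]) = (\<Union>T\<in>tableaux_of_content bs. add_entries (Suc (length bs)) s T)"
proof (intro equalityI subsetI)
  let ?n = "Suc (length bs)"
  fix T assume T: "T \<in> tableaux_of_content (bs @ [s])"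
  then have le: "\<forall>r\<in>set T. \<forall>x\<in>set r. x \<le> ?n" using tableaux_of_content_entry_le by fastforce
  have cnt: "count_list (concat T) ?n = s" using T by (simp add: tableaux_of_content_def)
  have "immaculate_filling T" using T by (simp add: tableaux_of_content_def)
  from immaculate_filling_restrict[OF this le] have
    "T \<in> add_entries ?n s (restrict_below ?n T)" "immaculate_filling (restrict_below ?n T)"
    unfolding cnt by blast+
  moreover from this have "restrict_below ?n T \<in> tableaux_of_content bs"
    using T by (auto simp: tableaux_of_content_def count_list_restrict_below nth_append)
  ultimately show "T \<in> (\<Union>T\<in>tableaux_of_content bs. add_entries ?n s T)" by blast
next
  let ?n = "Suc (length bs)"
  fix T' assume "T' \<in> (\<Union>T\<in>tableaux_of_content bs. add_entries ?n s T)"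
  then obtain T where T: "T \<in> tableaux_of_content bs" "T' \<in> add_entries ?n s T" by blast
  have "\<forall>r\<in>set T. \<forall>x\<in>set r. x < ?n" using tableaux_of_content_entry_le[OF T(1)] by fastforce
  then have "immaculate_filling T'"
    using immaculate_filling_add_entries[OF T(2)] T(1) by (simp add: tableaux_of_content_def)
  then show "T' \<in> tableaux_of_content (bs @ [s])"
    using T(1) by (auto simp: tableaux_of_content_def count_list_add_entries[OF T(2)] nth_append)
qed

lemma restrict_below_add_entries_tableau:
  assumes "T \<in> tableaux_of_content bs" "T' \<in> add_entries (Suc (length bs)) s T"
  shows "restrict_below (Suc (length bs)) T' = T"
  using assms(2)
proof (rule restrict_below_add_entries)
  show "\<forall>r\<in>set T. r \<noteq> [] \<and> (\<forall>x\<in>set r. x < Suc (length bs))"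
    using tableaux_of_content_entry_le[OF assms(1)] assms(1)
    by (auto simp: tableaux_of_content_def immaculate_filling_def less_Suc_eq_le)
qed

lemma finite_tableaux_of_content: "finite (tableaux_of_content bs)"
  by (induction bs rule: rev_induct)
     (simp_all add: tableaux_of_content_Nil tableaux_of_content_snoc finite_add_entries)

lemma Hword_eq_sum_tableaux:
  "Hword (map int bs) = (\<Sum>T\<in>tableaux_of_content bs. immaculate (map int (map length T)))"
proof (induction bs rule: rev_induct)
  case Nil
  then show ?case by (simp add: Hword_def tableaux_of_content_Nil immaculate_simps)
next
  case (snoc s bs)
  let ?im = "\<lambda>T. immaculate (map int (map length T))"
  have "Hword (map int (bs @ [s])) = Hword (map int bs) * H (int s)" by (simp add: Hword_def)
  also have "\<dots> = (\<Sum>T\<in>tableaux_of_content bs. \<Sum>T'\<in>add_entries (Suc (length bs)) s T. ?im T')"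
    unfolding snoc.IH sum_distrib_right immaculate_times_H[of _ s "Suc (length bs)"] ..
  also have "\<dots> = (\<Sum>T\<in>tableaux_of_content (bs @ [s]). ?im T)"
    unfolding tableaux_of_content_snoc
  proof (rule sum.UNION_disjoint[symmetric])
    \<comment> \<open>Restriction recovers the smaller tableau, so no grown tableau is counted
      twice.\<close>
    show "\<forall>T\<in>tableaux_of_content bs. \<forall>U\<in>tableaux_of_content bs. T \<noteq> U \<longrightarrow>
        add_entries (Suc (length bs)) s T \<inter> add_entries (Suc (length bs)) s U = {}"
      using restrict_below_add_entries_tableau by blast
  qed (simp_all add: finite_tableaux_of_content finite_add_entries)
  finally show ?case .
qed

section \<open>Triangularity\<close>

lemma append_row_in_add_entries: "s > 0 \<Longrightarrow> T @ [replicate s n] \<in> add_entries n s T"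
proof (induction T)
  case (Cons r T)
  then show ?case by (auto intro!: bexI[of _ 0])
qed simp

text \<open>Compare at the first row. If it outgrows the first part of \<open>bs\<close>, the order
  is strict; otherwise the lengths agree, no box was added there, and the comparison passes to the
  remaining rows.\<close>

lemma lex_add_entries:
  assumes "T' \<in> add_entries n s T" "s > 0"
    and "lexordp_eq bs (map length T)" "sum_list bs = sum_list (map length T)" "[] \<notin> set T"
  shows "lexordp_eq (bs @ [s]) (map length T') \<and>
    (map length T' = bs @ [s] \<longrightarrow> map length T = bs \<and> T' = T @ [replicate s n])"
  using assms
proof (induction T arbitrary: bs s T')
  case (Cons r T)
  obtain k T'' where k: "k \<le> s" "T'' \<in> add_entries n (s - k) T" "T' = (r @ replicate k n) # T''"
    using Cons.prems(1) by auto
  \<comment> \<open>An empty \<open>bs\<close> would have sum 0, but \<open>T\<close> has a nonempty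
    row.\<close>
  obtain b bs' where bs: "bs = b # bs'"
    using Cons.prems(4,5) by (cases bs) auto
  show ?case
  proof (cases "b = length r \<and> k = 0")
    case True
    then show ?thesis using Cons.IH[of T'' s bs'] Cons.prems k bs by auto
  next
    case False
    moreover have "b \<le> length r" using Cons.prems(3) bs by auto
    ultimately have "b < length r + k" by auto
    then show ?thesis using k bs by auto
  qed
qed (auto split: if_splits)

text \<open>Uniqueness is phrased as a singleton set so that it can be carried through the
  induction. The one tableau of shape \<open>bs\<close> has row \<open>i\<close> filled with
  \<open>i\<close>, and each step appends one such row.\<close>

lemma tableaux_of_content_lex:
  assumes "0 \<notin> set bs"
  shows "(\<forall>T\<in>tableaux_of_content bs. sum_list (map length T) = sum_list bs \<and> lexordp_eq bs (map length T))
    \<and> (\<exists>T. {T \<in> tableaux_of_content bs. map length T = bs} = {T})"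
  using assms
proof (induction bs rule: rev_induct)
  case Nil
  then show ?case by (auto simp: tableaux_of_content_Nil)
next
  case (snoc s bs)
  let ?n = "Suc (length bs)"
  have s: "s > 0" and IH: "\<And>T. T \<in> tableaux_of_content bs \<Longrightarrow> sum_list (map length T) = sum_list bs"
    "\<And>T. T \<in> tableaux_of_content bs \<Longrightarrow> lexordp_eq bs (map length T)"
    using snoc by auto
  obtain T0 where T0: "{T \<in> tableaux_of_content bs. map length T = bs} = {T0}"
    using snoc by auto
  then have T0': "T0 \<in> tableaux_of_content bs" "map length T0 = bs" by auto
  have lex: "lexordp_eq (bs @ [s]) (map length T') \<and>
    (map length T' = bs @ [s] \<longrightarrow> map length T = bs \<and> T' = T @ [replicate s ?n])"
    if "T \<in> tableaux_of_content bs" "T' \<in> add_entries ?n s T" for T T'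
    using lex_add_entries[OF that(2) s IH(2)[OF that(1)]] IH(1)[OF that(1)] that(1)
    by (auto simp: tableaux_of_content_def immaculate_filling_def)
  have "{T \<in> tableaux_of_content (bs @ [s]). map length T = bs @ [s]} = {T0 @ [replicate s ?n]}"
  proof (intro equalityI subsetI)
    fix T' assume "T' \<in> {T \<in> tableaux_of_content (bs @ [s]). map length T = bs @ [s]}"
    then obtain T where T: "T \<in> tableaux_of_content bs" "T' \<in> add_entries ?n s T" "map length T' = bs @ [s]"
      unfolding tableaux_of_content_snoc by blast
    then have "map length T = bs" "T' = T @ [replicate s ?n]" using lex by blast+
    moreover from this T(1) have "T = T0" using T0 by blast
    ultimately show "T' \<in> {T0 @ [replicate s ?n]}" by simp
  next
    fix T' assume "T' \<in> {T0 @ [replicate s ?n]}"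
    then show "T' \<in> {T \<in> tableaux_of_content (bs @ [s]). map length T = bs @ [s]}"
      using append_row_in_add_entries[OF s, of T0 ?n] T0' unfolding tableaux_of_content_snoc by auto
  qed
  moreover have "\<forall>T\<in>tableaux_of_content (bs @ [s]). sum_list (map length T) = sum_list (bs @ [s])
      \<and> lexordp_eq (bs @ [s]) (map length T)"
    unfolding tableaux_of_content_snoc using IH(1) lex by (auto simp: sum_length_add_entries)
  ultimately show ?case by blast
qed

text \<open>Parts of \<alpha> are positive, so the nonemptiness of rows required by
  \<open>immaculate_filling\<close> is automatic.\<close>

lemma immaculate_tableaux_eq:
  "immaculate_tableaux \<alpha> \<beta> = {T \<in> tableaux_of_content (parts \<beta>). map length T = parts \<alpha>}"
proof -
  have "[] \<notin> set T" if "map length T = parts \<alpha>" for T :: "nat list list"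
  proof
    assume "[] \<in> set T"
    then have "0 \<in> set (map length T)" by force
    then show False using parts[of \<alpha>] that by simp
  qed
  then show ?thesis
    by (auto simp: immaculate_tableaux_def tableaux_of_content_def immaculate_filling_def len_def)
qed

theorem theorem3p10:
  fixes \<beta> :: composition
  shows "Hword (int_parts \<beta>) =
           (\<Sum>\<alpha> | wt \<alpha> = wt \<beta> \<and> lex_le \<beta> \<alpha>. of_nat (K \<alpha> \<beta>) * immaculate (int_parts \<alpha>))
         \<and> K \<beta> \<beta> = 1"
proof
  let ?T = "tableaux_of_content (parts \<beta>)"
  let ?A = "{\<alpha>. wt \<alpha> = wt \<beta> \<and> lex_le \<beta> \<alpha>}"
  let ?im = "\<lambda>T. immaculate (map int (map length T))"
  have "0 \<notin> set (parts \<beta>)" using parts[of \<beta>] by simp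
  note lex = tableaux_of_content_lex[OF this]
  show "K \<beta> \<beta> = 1" using lex by (auto simp: K_def immaculate_tableaux_eq)
  define shape where "shape T = Composition (map length T)" for T :: "nat list list"
  have shape: "parts (shape T) = map length T" if "T \<in> ?T" for T
    unfolding shape_def using that
    by (intro Composition_inverse) (auto simp: tableaux_of_content_def immaculate_filling_def)
  have "finite ?A" by (rule finite_subset[OF _ finite_wt[of "wt \<beta>"]]) auto
  moreover have "shape ` ?T \<subseteq> ?A"
    using lex shape by (auto simp: wt_def lex_le_def)
  \<comment> \<open>Group the tableaux by shape. Each fibre has \<open>K \<alpha> \<beta>\<close>
    elements, all contributing the same immaculate function; shapes without tableaux contribute
    0.\<close>
  ultimately have "(\<Sum>T\<in>?T. ?im T) = (\<Sum>\<alpha>\<in>?A. \<Sum>T | T \<in> ?T \<and> shape T = \<alpha>. ?im T)"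
    by (simp only: sum.group[OF finite_tableaux_of_content])
  also have "\<dots> = (\<Sum>\<alpha>\<in>?A. of_nat (K \<alpha> \<beta>) * immaculate (int_parts \<alpha>))"
  proof (rule sum.cong[OF refl])
    fix \<alpha>
    have "{T. T \<in> ?T \<and> shape T = \<alpha>} = immaculate_tableaux \<alpha> \<beta>"
      using shape by (auto simp: immaculate_tableaux_eq simp flip: parts_inject)
    then show "(\<Sum>T | T \<in> ?T \<and> shape T = \<alpha>. ?im T) = of_nat (K \<alpha> \<beta>) * immaculate (int_parts \<alpha>)"
      by (simp add: K_def immaculate_tableaux_eq int_parts_def)
  qed
  finally show "Hword (int_parts \<beta>) = (\<Sum>\<alpha>\<in>?A. of_nat (K \<alpha> \<beta>) * immaculate (int_parts \<alpha>))"
    by (simp add: int_parts_def Hword_eq_sum_tableaux)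
qed

end
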